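(* Let $A$ be an arbitrary nonempty set. For any set $\mathcal{M} \subseteq \mathcal{M}_A$ of matrix collections on $A$, the following two conditions are equivalent: (i) $\mathcal{M}$ is locally closed and contains the binary equality matrix collection $E_2$, the unary empty matrix collection, and all unary trivial matrix collections $\Omega_1^{(p)}$ of breadth $p \geq 0$, and it is closed under formation of conjunctive minors, unions, quotients, and dividends. (ii) $\mathcal{M}$ is characterized by some set of operations on $A$; that is, there is a set $\mathcal{F} \subseteq \mathcal{O}_A$ such that $\mathcal{M} = \{\Gamma \in \mathcal{M}_A \mid \forall f \in \mathcal{F} \colon f \vartriangleright \Gamma\}$.
   Context: Operations. An operation on $A$ is a map $f \colon A^n \to A$ for some integer $n \geq 1$; $\mathcal{O}_A^{(n)}$ is the set of $n$-ary operations and $\mathcal{O}_A := \bigcup_{n \geq 1} \mathcal{O}_A^{(n)}$. Matrix collections. $A^{m \times n}$ is the set of matrices with $m$ rows and $n$ columns with entries in $A$. For an integer $m \geq 1$, an $m$-ary matrix collection on $A$ is a subset $\Gamma \subseteq \bigcup_{p \geq 0} A^{m \times p}$ (for $p=0$ there is a unique, empty, matrix $()$); $\mathcal{M}_A^{(m)}$ is the set of all $m$-ary matrix collections, and $\mathcal{M}_A := \bigcup_{m \geq 1} \mathcal{M}_A^{(m)}$. $[\mathbf{M}_1 | \mathbf{M}_2 | \cdots]$ denotes horizontal juxtaposition of matrices with the same number of rows (matrices with $0$ columns allowed). Preservation. For $f \in \mathcal{O}_A^{(n)}$ and $\mathbf{M} \in A^{m \times n}$, $f\mathbf{M}$ is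 the column vector obtained by applying $f$ to each row of $\mathbf{M}$. $f \in \mathcal{O}_A^{(n)}$ preserves $\Gamma \in \mathcal{M}_A^{(m)}$, written $f \vartriangleright \Gamma$, if for all $m$-row matrices $\mathbf{M} = [\mathbf{M}_1 | \mathbf{M}_2 | \mathbf{M}_3]$ where $\mathbf{M}_2$ has $n$ columns, $\mathbf{M} \in \Gamma$ implies $[\mathbf{M}_1 | f\mathbf{M}_2 | \mathbf{M}_3] \in \Gamma$. Special collections. $\Omega_m^{(p)}$ ($p \geq 0$), the $m$-ary trivial matrix collection of breadth $p$, is the set of all $m$-row matrices on $A$ with at most $p$ columns. The empty matrix collection (of any arity) is the empty set $\emptyset$; note $\Omega_m^{(0)} = \{()\} \neq \emptyset$. $E_2$, the binary equality matrix collection, is the set of all two-row matrices with any finite number of columns such that the two rows are identical. Conjunctive minors. View positive integers as ordinals, $m = \{0, \dots, m-1\}$, so an $m$-tuple $\mathbf{a} \in A^m$ is a map $m \to A$. Let $V$ be an arbitrary set disjoint from the ordinals (the indeterminates), $h \colon n \to m \cup V$ a map and $\sigma \colon V \to A$ a map (Skolem map). For $\mathbf{a} \in A^m$, $(\mathbf{a} + \sigma)h \in A^n$ is the $n$-tuple whose $i$-th entry is $\mathbf{a}(h(i))$ if $h(i) \in m$ and $\sigma(h(i))$ if $h(i) \in V$. A minor formation scheme with target $m$, indeterminate set $V$ and source family $(n_j)_{j \in J}$ is a nonempty family $H = (h_j)_{j \in J}$ of maps $h_j \colon n_j \to m \cup V$ ($m$ and all $n_j$ positive integers). Let $(\Gamma_j)_{j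 \in J}$ be a family of matrix collections with $\Gamma_j$ of arity $n_j$. An $m$-ary matrix collection $\Gamma$ is a conjunctive minor of $(\Gamma_j)_{j \in J}$ via $H$ if for every matrix $\mathbf{M} = (\mathbf{a}_{*1}, \dots, \mathbf{a}_{*n}) \in A^{m \times n}$ (with columns $\mathbf{a}_{*i}$, for any finite number $n$ of columns), $$\mathbf{M} \in \Gamma \Longleftrightarrow \exists \sigma_1, \dots, \sigma_n \in A^V \ \forall j \in J \colon \bigl( (\mathbf{a}_{*1} + \sigma_1)h_j, \dots, (\mathbf{a}_{*n} + \sigma_n)h_j \bigr) \in \Gamma_j.$$ $\mathcal{M}$ is closed under formation of conjunctive minors if all conjunctive minors of nonempty families of members of $\mathcal{M}$ are members of $\mathcal{M}$. Quotients. For an $m$-ary $\Gamma$ and an $m$-row matrix $\mathbf{N}$: $\Gamma / \mathbf{N} := \{\mathbf{M} \mid [\mathbf{M} | \mathbf{N}] \in \Gamma\}$ and $\mathbf{N} \backslash \Gamma := \{\mathbf{M} \mid [\mathbf{N} | \mathbf{M}] \in \Gamma\}$; moreover $\mathbf{N}_1 \backslash \Gamma / \mathbf{N}_2 := \{\mathbf{M} \mid [\mathbf{N}_1 | \mathbf{M} | \mathbf{N}_2] \in \Gamma\}$. $\mathcal{M}$ is closed under quotients if for every $\Gamma \in \mathcal{M}$ all left and right quotients $\mathbf{N} \backslash \Gamma$ and $\Gamma / \mathbf{N}$ are in $\mathcal{M}$. Other closure conditions. $\mathcal{M}$ is closed under dividends if for every $\Gamma \in \mathcal{M}_A$, say of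 arity $m$, $\Gamma \in \mathcal{M}$ whenever there is an integer $p \geq 0$ such that $\Omega_m^{(p)} \subseteq \Gamma$ and $\mathbf{N}_1 \backslash \Gamma / \mathbf{N}_2 \in \mathcal{M}$ for all $m$-row matrices $[\mathbf{N}_1 | \mathbf{N}_2]$ with at least $p$ columns. With $\Gamma^{(p)} := \Gamma \cap \Omega_m^{(p)}$ for $m$-ary $\Gamma$, $\mathcal{M}$ is locally closed if $\Gamma \in \mathcal{M}$ whenever $\Gamma^{(p)} \in \mathcal{M}$ for all $p \geq 0$. $\mathcal{M}$ is closed under unions if $\bigcup_{j \in J} \Gamma_j \in \mathcal{M}$ whenever $(\Gamma_j)_{j \in J}$ is a family of $m$-ary matrix collections from $\mathcal{M}$.
   Formalization: The condition defining a conjunctive minor is imposed only for matrices with n ≥ 1 columns, so whether the empty matrix () belongs to a minor is left free; with n = 0 included the equivalence fails, e.g. for |A| = 1. *)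

theory Defs
  imports Main "HOL-Library.FuncSet"
begin

text \<open>The base set is the universe of the type \<^typ>\<open>'a\<close>.  A matrix is the list of its columns and a
  column is the list of its entries, so that horizontal juxtaposition is list append, and there is
  only one matrix without columns, whatever the number of rows.\<close>

type_synonym 'a matrix = "'a list list"
type_synonym 'a collection = "'a matrix set"
type_synonym 'a operation = "nat \<times> ('a list \<Rightarrow> 'a)"

definition operations :: "'a operation set" where
  "operations = {(n, f). n \<ge> 1 \<and> f \<in> {xs. length xs = n} \<rightarrow>\<^sub>E UNIV}"

definition matrices :: "nat \<Rightarrow> 'a matrix set" where
  "matrices m = {M. \<forall>c \<in> set M. length c = m}"

definition collections :: "nat \<Rightarrow> 'a collection set" where
  "collections m = Pow (matrices m)"

definition all_collections :: "'a collection set" where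
  "all_collections = (\<Union>m \<in> {1..}. collections m)"

definition apply_rows :: "nat \<Rightarrow> ('a list \<Rightarrow> 'a) \<Rightarrow> 'a matrix \<Rightarrow> 'a list" where
  "apply_rows m f M = map (\<lambda>i. f (map (\<lambda>c. c ! i) M)) [0..<m]"

fun preserves :: "'a operation \<Rightarrow> 'a collection \<Rightarrow> bool" where
  "preserves (n, f) \<Gamma> \<longleftrightarrow>
     (\<forall>m M1 M2 M3. M1 \<in> matrices m \<and> M2 \<in> matrices m \<and> M3 \<in> matrices m \<and> length M2 = n \<and>
        M1 @ M2 @ M3 \<in> \<Gamma> \<longrightarrow> M1 @ [apply_rows m f M2] @ M3 \<in> \<Gamma>)"

definition characterized_by_operations :: "'a collection set \<Rightarrow> bool" where
  "characterized_by_operations \<M> \<longleftrightarrow>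
     (\<exists>F \<subseteq> operations. \<M> = {\<Gamma> \<in> all_collections. \<forall>f \<in> F. preserves f \<Gamma>})"

definition trivial_collection :: "nat \<Rightarrow> nat \<Rightarrow> 'a collection" where
  "trivial_collection m p = {M \<in> matrices m. length M \<le> p}"

definition equality_collection :: "'a collection" where
  "equality_collection = {M \<in> matrices 2. \<forall>c \<in> set M. c ! 0 = c ! 1}"

text \<open>A map from \<open>n\<close> to \<open>m \<union> V\<close>, where \<open>V\<close> is disjoint from the ordinals, is a list of length \<open>n\<close>
  with entries in the disjoint sum \<open>{..<m} <+> V\<close>.  Skolem maps are total functions; only their
  values on \<open>V\<close> are ever used.\<close>

definition substitute :: "'a list \<Rightarrow> ('v \<Rightarrow> 'a) \<Rightarrow> (nat + 'v) list \<Rightarrow> 'a list" where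
  "substitute a \<sigma> h = map (case_sum (\<lambda>i. a ! i) \<sigma>) h"

definition minor_formation_scheme ::
    "nat \<Rightarrow> 'v set \<Rightarrow> 'j set \<Rightarrow> ('j \<Rightarrow> nat) \<Rightarrow> ('j \<Rightarrow> (nat + 'v) list) \<Rightarrow> bool" where
  "minor_formation_scheme m V J n H \<longleftrightarrow> m \<ge> 1 \<and> J \<noteq> {} \<and>
     (\<forall>j \<in> J. n j \<ge> 1 \<and> length (H j) = n j \<and> set (H j) \<subseteq> {..<m} <+> V)"

text \<open>The defining equivalence of a conjunctive minor is about matrices with columns
  \<open>a\<^sub>1, \<dots>, a\<^sub>n\<close>, \<open>n \<ge> 1\<close>; it does not say whether the matrix without columns belongs to
  the minor.  This matters: no operation of arity at least one can distinguish \<open>\<Gamma>\<close> from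
  \<open>\<Gamma> - {[]}\<close>, whereas, if the equivalence were also required for \<open>n = 0\<close>, then over a one-element
  set the collections that are empty or consist of all matrices with at most \<open>p\<close> columns
  (\<open>p = 0, 1, \<dots>, \<infinity>\<close>) would satisfy all the closure conditions below, without including the
  collection of all matrices with exactly one column, which every operation preserves.\<close>

definition conjunctive_minor ::
    "nat \<Rightarrow> 'j set \<Rightarrow> ('j \<Rightarrow> (nat + 'v) list) \<Rightarrow> ('j \<Rightarrow> 'a collection) \<Rightarrow> 'a collection \<Rightarrow> bool" where
  "conjunctive_minor m J H \<Gamma>s \<Gamma> \<longleftrightarrow> \<Gamma> \<in> collections m \<and>
     (\<forall>M \<in> matrices m. M \<noteq> [] \<longrightarrow>
        (M \<in> \<Gamma> \<longleftrightarrow>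
          (\<exists>\<sigma>s :: ('v \<Rightarrow> 'a) list. length \<sigma>s = length M \<and>
             (\<forall>j \<in> J. map2 (\<lambda>a \<sigma>. substitute a \<sigma> (H j)) M \<sigma>s \<in> \<Gamma>s j))))"

text \<open>The sets of indeterminates and of indices range over the subsets of the type \<^typ>\<open>'u\<close>.\<close>

definition closed_under_conjunctive_minors :: "'u itself \<Rightarrow> 'a collection set \<Rightarrow> bool" where
  "closed_under_conjunctive_minors (_ :: 'u itself) \<M> \<longleftrightarrow>
     (\<forall>m (V :: 'u set) (J :: 'u set) n H \<Gamma>s \<Gamma>.
        minor_formation_scheme m V J n H \<and> (\<forall>j \<in> J. \<Gamma>s j \<in> \<M> \<inter> collections (n j)) \<and>
        conjunctive_minor m J H \<Gamma>s \<Gamma> \<longrightarrow> \<Gamma> \<in> \<M>)"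

definition left_quotient :: "'a matrix \<Rightarrow> 'a collection \<Rightarrow> 'a collection" where
  "left_quotient N \<Gamma> = {M. N @ M \<in> \<Gamma>}"

definition right_quotient :: "'a collection \<Rightarrow> 'a matrix \<Rightarrow> 'a collection" where
  "right_quotient \<Gamma> N = {M. M @ N \<in> \<Gamma>}"

definition two_sided_quotient :: "'a matrix \<Rightarrow> 'a collection \<Rightarrow> 'a matrix \<Rightarrow> 'a collection" where
  "two_sided_quotient N1 \<Gamma> N2 = {M. N1 @ M @ N2 \<in> \<Gamma>}"

definition closed_under_quotients :: "'a collection set \<Rightarrow> bool" where
  "closed_under_quotients \<M> \<longleftrightarrow>
     (\<forall>m \<ge> 1. \<forall>\<Gamma> \<in> \<M> \<inter> collections m. \<forall>N \<in> matrices m.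
        left_quotient N \<Gamma> \<in> \<M> \<and> right_quotient \<Gamma> N \<in> \<M>)"

definition closed_under_dividends :: "'a collection set \<Rightarrow> bool" where
  "closed_under_dividends \<M> \<longleftrightarrow>
     (\<forall>m \<ge> 1. \<forall>\<Gamma> \<in> collections m.
        (\<exists>p. trivial_collection m p \<subseteq> \<Gamma> \<and>
           (\<forall>N1 \<in> matrices m. \<forall>N2 \<in> matrices m.
              length (N1 @ N2) \<ge> p \<longrightarrow> two_sided_quotient N1 \<Gamma> N2 \<in> \<M>)) \<longrightarrow> \<Gamma> \<in> \<M>)"

definition locally_closed :: "'a collection set \<Rightarrow> bool" where
  "locally_closed \<M> \<longleftrightarrow>
     (\<forall>m \<ge> 1. \<forall>\<Gamma> \<in> collections m. (\<forall>p. \<Gamma> \<inter> trivial_collection m p \<in> \<M>) \<longrightarrow> \<Gamma> \<in> \<M>)"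

definition closed_under_unions :: "'a collection set \<Rightarrow> bool" where
  "closed_under_unions \<M> \<longleftrightarrow> (\<forall>m \<ge> 1. \<forall>\<G> \<subseteq> \<M> \<inter> collections m. \<Union>\<G> \<in> \<M>)"

text \<open>Schemes with arbitrarily large sets of indeterminates and of indices are wanted, but a formula
  can only quantify over the subsets of one type.  In the main statement this type is
  \<^typ>\<open>'u + 'a collection\<close> with \<^typ>\<open>'u\<close> arbitrary: the first summand brings in all sets of
  any type, and the second one ensures that the universe is not too small (with too few
  indeterminates and indices the closure conditions would not yield enough conjunctive minors).\<close>

end

theory Submission
  imports Defs
begin

text \<open>For \<open>(i) \<Longrightarrow> (ii)\<close> let \<open>F\<close> be the set of all operations preserving every member of
  \<open>\<M>\<close>, and for a matrix \<open>M\<close> let \<open>\<Gamma>\<^sub>M\<close> consist of the matrices \<open>[f\<^sub>1 M\<^sub>1 | \<dots> | f\<^sub>k M\<^sub>k]\<close> with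
  \<open>M = [M\<^sub>1 | \<dots> | M\<^sub>k]\<close> and \<open>f\<^sub>i \<in> F\<close>.  A collection preserved by \<open>F\<close> is the union of the \<open>\<Gamma>\<^sub>M\<close>
  with \<open>M\<close> in it, so it suffices that every \<open>\<Gamma>\<^sub>M\<close> is in \<open>\<M>\<close>; this goes by induction on the number
  \<open>n\<close> of columns of \<open>M\<close>.  The quotients of \<open>\<Omega>\<^sup>(\<^sup>1\<^sup>) \<union> \<Gamma>\<^sub>M\<close> by nonempty matrices are, up to the
  empty matrix, unions of collections \<open>\<Gamma>\<^sub>L\<close> with \<open>L\<close> a proper segment of \<open>M\<close>; hence
  \<open>\<Omega>\<^sup>(\<^sup>1\<^sup>) \<union> \<Gamma>\<^sub>M \<in> \<M>\<close> by closure under dividends.  The matrices with a single column are cut down by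
  intersecting with a conjunctive minor whose indeterminates are the elements of \<open>A\<^sup>n\<close>: a Skolem map
  for a one-column matrix in it is an \<open>n\<close>-ary operation in \<open>F\<close>, which produces that column from \<open>M\<close>.\<close>

section \<open>Matrices, and preservation tested at a fixed arity\<close>

lemma matrices_append [simp]: "M @ N \<in> matrices m \<longleftrightarrow> M \<in> matrices m \<and> N \<in> matrices m"
  by (auto simp: matrices_def)

lemma matrices_Cons [simp]: "c # N \<in> matrices m \<longleftrightarrow> length c = m \<and> N \<in> matrices m"
  by (auto simp: matrices_def)

lemma matrices_Nil [simp]: "[] \<in> matrices m"
  by (simp add: matrices_def)

lemma length_apply_rows [simp]: "length (apply_rows m f M) = m"
  by (simp add: apply_rows_def)

lemma nth_apply_rows [simp]: "i < m \<Longrightarrow> apply_rows m f M ! i = f (map (\<lambda>c. c ! i) M)"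
  by (simp add: apply_rows_def)

lemma length_substitute [simp]: "length (substitute a \<sigma> h) = length h"
  by (simp add: substitute_def)

lemma equality_collection_in_collections: "equality_collection \<in> collections 2"
  by (auto simp: equality_collection_def collections_def)

lemma trivial_collection_in_collections: "trivial_collection m p \<in> collections m"
  by (auto simp: trivial_collection_def collections_def)

text \<open>A collection does not record its arity, so \<open>preserves\<close> ranges over all row
  numbers. Since \<open>n \<ge> 1\<close>, the block \<open>M2\<close> has a column, and its length
  forces the row number to be \<open>m\<close>.\<close>

lemma preservesI:
  assumes "\<Gamma> \<in> collections m" "n \<ge> 1"
    and "\<And>M1 M2 M3. M1 \<in> matrices m \<Longrightarrow> M2 \<in> matrices m \<Longrightarrow> M3 \<in> matrices m \<Longrightarrow>
      length M2 = n \<Longrightarrow> M1 @ M2 @ M3 \<in> \<Gamma> \<Longrightarrow> M1 @ [apply_rows m f M2] @ M3 \<in> \<Gamma>"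
  shows "preserves (n, f) \<Gamma>"
  unfolding preserves.simps
proof (intro allI impI, elim conjE)
  fix k M1 M2 M3
  assume *: "M1 \<in> matrices k" "M2 \<in> matrices k" "M3 \<in> matrices k" "length M2 = n"
    "M1 @ M2 @ M3 \<in> \<Gamma>"
  then have "M1 @ M2 @ M3 \<in> matrices m"
    using assms(1) by (auto simp: collections_def)
  then have "k = m"
    using * assms(2) by (cases M2) auto
  then show "M1 @ [apply_rows k f M2] @ M3 \<in> \<Gamma>"
    using assms(3) * by blast
qed

lemma preservesD:
  assumes "preserves (n, f) \<Gamma>" "\<Gamma> \<in> collections m" "M1 @ M2 @ M3 \<in> \<Gamma>" "length M2 = n"
  shows "M1 @ [apply_rows m f M2] @ M3 \<in> \<Gamma>"
proof -
  have "M1 @ M2 @ M3 \<in> matrices m"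
    using assms(2,3) by (auto simp: collections_def)
  then show ?thesis
    using assms(1,3,4) by simp
qed

section \<open>Closure properties of characterized sets\<close>

text \<open>One application of \<open>f\<close> concerns one matrix, so the truncation at the number
  of columns of that matrix suffices.\<close>

lemma preserves_if_truncations_preserved:
  assumes "n \<ge> 1" "\<Gamma> \<in> collections m" "\<And>p. preserves (n, f) (\<Gamma> \<inter> trivial_collection m p)"
  shows "preserves (n, f) \<Gamma>"
proof (rule preservesI[OF assms(2,1)])
  fix M1 M2 M3
  assume *: "M1 \<in> matrices m" "M2 \<in> matrices m" "M3 \<in> matrices m" "length M2 = n" "M1 @ M2 @ M3 \<in> \<Gamma>"
  let ?p = "length (M1 @ M2 @ M3)"
  have "M1 @ M2 @ M3 \<in> \<Gamma> \<inter> trivial_collection m ?p"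
    using * by (simp add: trivial_collection_def)
  moreover have "\<Gamma> \<inter> trivial_collection m ?p \<in> collections m"
    using assms(2) by (auto simp: collections_def)
  ultimately show "M1 @ [apply_rows m f M2] @ M3 \<in> \<Gamma>"
    using preservesD[OF assms(3)] * by blast
qed

lemma preserves_equality_collection:
  assumes "n \<ge> 1"
  shows "preserves (n, f) equality_collection"
proof (rule preservesI[of _ 2])
  fix M1 M2 M3 :: "'a matrix"
  assume "M2 \<in> matrices 2" "M1 @ M2 @ M3 \<in> equality_collection"
  then have "map (\<lambda>c. c ! 0) M2 = map (\<lambda>c. c ! 1) M2"
    by (simp add: equality_collection_def)
  then have "apply_rows 2 f M2 ! 0 = apply_rows 2 f M2 ! 1"
    by (simp del: map_eq_conv)
  then show "M1 @ [apply_rows 2 f M2] @ M3 \<in> equality_collection"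
    using \<open>M1 @ M2 @ M3 \<in> equality_collection\<close> by (auto simp: equality_collection_def)
qed (use assms equality_collection_in_collections in auto)

text \<open>Collapsing \<open>n \<ge> 1\<close> columns into one never increases the number of
  columns.\<close>

lemma preserves_trivial_collection: "n \<ge> 1 \<Longrightarrow> preserves (n, f) (trivial_collection m p)"
  by (rule preservesI[OF trivial_collection_in_collections]) (auto simp: trivial_collection_def)

text \<open>Collapsing a block commutes with substitution if \<open>f\<close> is also applied
  pointwise to the Skolem maps of that block; this yields the new Skolem map
  \<open>\<tau>\<close>.\<close>

lemma preserves_conjunctive_minor:
  fixes V :: "'v set"
  assumes n: "n \<ge> 1" and scheme: "minor_formation_scheme m V J k H"
    and \<Gamma>s: "\<And>j. j \<in> J \<Longrightarrow> \<Gamma>s j \<in> collections (k j) \<and> preserves (n, f) (\<Gamma>s j)"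
    and minor: "conjunctive_minor m J H \<Gamma>s \<Gamma>"
  shows "preserves (n, f) \<Gamma>"
proof (rule preservesI[OF _ n])
  show "\<Gamma> \<in> collections m"
    using minor by (simp add: conjunctive_minor_def)
next
  fix M1 M2 M3
  assume M: "M1 \<in> matrices m" "M2 \<in> matrices m" "M3 \<in> matrices m"
    and len: "length M2 = n" and "M1 @ M2 @ M3 \<in> \<Gamma>"
  let ?sub = "\<lambda>j. map2 (\<lambda>a \<sigma>. substitute a \<sigma> (H j))"
  \<comment> \<open>The defining equivalence of a minor speaks of nonempty matrices only; here
    \<open>M2\<close> has \<open>n \<ge> 1\<close> columns.\<close>
  have "M1 @ M2 @ M3 \<in> matrices m \<and> M1 @ M2 @ M3 \<noteq> []"
    using M n len by auto
  then have "\<exists>\<sigma>s. length \<sigma>s = length (M1 @ M2 @ M3) \<and> (\<forall>j\<in>J. ?sub j (M1 @ M2 @ M3) \<sigma>s \<in> \<Gamma>s j)"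
    using minor \<open>M1 @ M2 @ M3 \<in> \<Gamma>\<close> unfolding conjunctive_minor_def by blast
  then obtain \<sigma>s where \<sigma>s: "length \<sigma>s = length (M1 @ M2 @ M3)"
      "\<And>j. j \<in> J \<Longrightarrow> ?sub j (M1 @ M2 @ M3) \<sigma>s \<in> \<Gamma>s j"
    by blast
  obtain \<sigma>1 \<sigma>2 \<sigma>3 where \<sigma>: "\<sigma>s = \<sigma>1 @ \<sigma>2 @ \<sigma>3"
    "length \<sigma>1 = length M1" "length \<sigma>2 = length M2" "length \<sigma>3 = length M3"
  proof
    show "\<sigma>s = take (length M1) \<sigma>s @ take (length M2) (drop (length M1) \<sigma>s) @
        drop (length M2) (drop (length M1) \<sigma>s)"
      by (simp only: append_take_drop_id)
  qed (use \<sigma>s in auto)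
  define \<tau> where "\<tau> v = f (map (\<lambda>\<sigma>. \<sigma> v) \<sigma>2)" for v
  have "?sub j (M1 @ [apply_rows m f M2] @ M3) (\<sigma>1 @ [\<tau>] @ \<sigma>3) \<in> \<Gamma>s j" if j: "j \<in> J" for j
  proof -
    have "?sub j M1 \<sigma>1 @ ?sub j M2 \<sigma>2 @ ?sub j M3 \<sigma>3 \<in> \<Gamma>s j"
      using \<sigma>s(2)[OF j] \<sigma> by simp
    then have "?sub j M1 \<sigma>1 @ [apply_rows (k j) f (?sub j M2 \<sigma>2)] @ ?sub j M3 \<sigma>3 \<in> \<Gamma>s j"
      by (rule preservesD[OF conjunct2[OF \<Gamma>s[OF j]] conjunct1[OF \<Gamma>s[OF j]]]) (simp add: len \<sigma>)
    moreover have "apply_rows (k j) f (?sub j M2 \<sigma>2) = substitute (apply_rows m f M2) \<tau> (H j)"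
    proof (rule nth_equalityI)
      fix i assume "i < length (apply_rows (k j) f (?sub j M2 \<sigma>2))"
      then have i: "i < k j" by simp
      have lenH: "length (H j) = k j" and "set (H j) \<subseteq> {..<m} <+> V"
        using scheme j by (auto simp: minor_formation_scheme_def)
      then have Hi: "H j ! i \<in> {..<m} <+> V"
        using i nth_mem[of i "H j"] by (simp add: subset_iff)
      note Hj = lenH Hi
      show "apply_rows (k j) f (?sub j M2 \<sigma>2) ! i = substitute (apply_rows m f M2) \<tau> (H j) ! i"
      proof (cases "H j ! i")
        case (Inl r)
        then have "map (\<lambda>c. c ! i) (?sub j M2 \<sigma>2) = map (\<lambda>c. c ! r) M2"
          using i Hj \<sigma> by (simp add: list_eq_iff_nth_eq substitute_def)
        then show ?thesis
          using i Hj Inl by (auto simp: substitute_def)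
      next
        case (Inr v)
        then have "map (\<lambda>c. c ! i) (?sub j M2 \<sigma>2) = map (\<lambda>\<sigma>. \<sigma> v) \<sigma>2"
          using i Hj \<sigma> by (simp add: list_eq_iff_nth_eq substitute_def)
        then show ?thesis
          using i Hj Inr by (simp add: substitute_def \<tau>_def)
      qed
    qed (use scheme j in \<open>simp add: minor_formation_scheme_def\<close>)
    ultimately show ?thesis
      using \<sigma> by simp
  qed
  moreover have "length (\<sigma>1 @ [\<tau>] @ \<sigma>3) = length (M1 @ [apply_rows m f M2] @ M3)"
    using \<sigma> by simp
  moreover have "M1 @ [apply_rows m f M2] @ M3 \<in> matrices m" "M1 @ [apply_rows m f M2] @ M3 \<noteq> []"
    using M by simp_all
  ultimately show "M1 @ [apply_rows m f M2] @ M3 \<in> \<Gamma>"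
    using minor unfolding conjunctive_minor_def by blast
qed

lemma preserves_two_sided_quotient:
  assumes "preserves (n, f) \<Gamma>" "n \<ge> 1" "\<Gamma> \<in> collections m"
  shows "preserves (n, f) (two_sided_quotient N1 \<Gamma> N2)"
proof (rule preservesI[OF _ assms(2)])
  show "two_sided_quotient N1 \<Gamma> N2 \<in> collections m"
    using assms(3) by (auto simp: two_sided_quotient_def collections_def)
next
  fix M1 M2 M3 assume "length M2 = n" "M1 @ M2 @ M3 \<in> two_sided_quotient N1 \<Gamma> N2"
  then show "M1 @ [apply_rows m f M2] @ M3 \<in> two_sided_quotient N1 \<Gamma> N2"
    using preservesD[OF assms(1,3), of "N1 @ M1" M2 "M3 @ N2"]
    by (simp add: two_sided_quotient_def)
qed

lemma left_quotient_eq: "left_quotient N \<Gamma> = two_sided_quotient N \<Gamma> []"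
  by (simp add: left_quotient_def two_sided_quotient_def)

lemma right_quotient_eq: "right_quotient \<Gamma> N = two_sided_quotient [] \<Gamma> N"
  by (simp add: right_quotient_def two_sided_quotient_def)

lemma two_sided_quotient_in_collections:
  "\<Gamma> \<in> collections m \<Longrightarrow> two_sided_quotient N1 \<Gamma> N2 \<in> collections m"
  by (auto simp: two_sided_quotient_def collections_def)

text \<open>If the context \<open>M1\<close>, \<open>M3\<close> has at least \<open>p\<close>
  columns, the quotient by it carries the step. Otherwise the result, one column longer than the
  context, has at most \<open>p\<close> columns and is in the trivial collection.\<close>

lemma preserves_dividend:
  assumes "n \<ge> 1" "\<Gamma> \<in> collections m" "trivial_collection m p \<subseteq> \<Gamma>"
    and quot: "\<And>N1 N2. N1 \<in> matrices m \<Longrightarrow> N2 \<in> matrices m \<Longrightarrow> length (N1 @ N2) \<ge> p \<Longrightarrow>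
      preserves (n, f) (two_sided_quotient N1 \<Gamma> N2)"
  shows "preserves (n, f) \<Gamma>"
proof (rule preservesI[OF assms(2,1)])
  fix M1 M2 M3
  assume M: "M1 \<in> matrices m" "M2 \<in> matrices m" "M3 \<in> matrices m" "length M2 = n" "M1 @ M2 @ M3 \<in> \<Gamma>"
  show "M1 @ [apply_rows m f M2] @ M3 \<in> \<Gamma>"
  proof (cases "length (M1 @ M3) \<ge> p")
    case True
    have "[] @ M2 @ [] \<in> two_sided_quotient M1 \<Gamma> M3"
      using M by (simp add: two_sided_quotient_def)
    then have "[] @ [apply_rows m f M2] @ [] \<in> two_sided_quotient M1 \<Gamma> M3"
      using preservesD[OF quot] two_sided_quotient_in_collections assms(2) M True by blast
    then show ?thesis
      by (simp add: two_sided_quotient_def)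
  next
    case False
    then have "M1 @ [apply_rows m f M2] @ M3 \<in> trivial_collection m p"
      using M by (simp add: trivial_collection_def)
    then show ?thesis
      using assms(3) by blast
  qed
qed

lemma in_all_collectionsI: "m \<ge> 1 \<Longrightarrow> \<Gamma> \<in> collections m \<Longrightarrow> \<Gamma> \<in> all_collections"
  by (auto simp: all_collections_def)

lemma closure_properties_if_characterized:
  fixes \<M> :: "'a collection set"
  assumes F: "F \<subseteq> operations" and \<M>: "\<M> = {\<Gamma> \<in> all_collections. \<forall>f \<in> F. preserves f \<Gamma>}"
  shows "locally_closed \<M>" "equality_collection \<in> \<M>" "{} \<in> \<M>" "trivial_collection 1 p \<in> \<M>"
    "closed_under_conjunctive_minors TYPE('v) \<M>" "closed_under_unions \<M>"
    "closed_under_quotients \<M>" "closed_under_dividends \<M>"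
proof -
  have inI: "\<Gamma> \<in> \<M>"
    if m: "m \<ge> 1" "\<Gamma> \<in> collections m" and pres: "\<And>n f. n \<ge> 1 \<Longrightarrow> (n, f) \<in> F \<Longrightarrow> preserves (n, f) \<Gamma>"
    for m \<Gamma>
  proof -
    have "preserves f \<Gamma>" if "f \<in> F" for f
      using \<open>f \<in> F\<close> F pres[of "fst f" "snd f"] by (auto simp: operations_def)
    then show ?thesis
      using m in_all_collectionsI unfolding \<M> by blast
  qed
  have inD: "preserves (n, f) \<Gamma>" if "\<Gamma> \<in> \<M>" "(n, f) \<in> F" for \<Gamma> n f
    using that \<M> by blast
  show "locally_closed \<M>"
    unfolding locally_closed_def
  proof (intro allI impI ballI)
    fix m :: nat and \<Gamma>
    assume *: "m \<ge> 1" "\<Gamma> \<in> collections m" "\<forall>p. \<Gamma> \<inter> trivial_collection m p \<in> \<M>"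
    show "\<Gamma> \<in> \<M>"
      by (rule inI[OF *(1,2)], rule preserves_if_truncations_preserved[OF _ *(2)]) (use * inD in blast)+
  qed
  show "equality_collection \<in> \<M>"
    by (rule inI[OF _ equality_collection_in_collections preserves_equality_collection]) auto
  show "{} \<in> \<M>"
    by (rule inI[of 1]) (auto simp: collections_def)
  show "trivial_collection 1 p \<in> \<M>"
    by (rule inI[OF _ trivial_collection_in_collections preserves_trivial_collection]) auto
  show "closed_under_conjunctive_minors TYPE('v) \<M>"
    unfolding closed_under_conjunctive_minors_def
  proof (intro allI impI, elim conjE)
    fix m and V :: "'v set" and J :: "'v set" and n H \<Gamma>s \<Gamma>
    assume *: "minor_formation_scheme m V J n H" "\<forall>j\<in>J. \<Gamma>s j \<in> \<M> \<inter> collections (n j)"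
      "conjunctive_minor m J H \<Gamma>s \<Gamma>"
    show "\<Gamma> \<in> \<M>"
    proof (rule inI)
      show "m \<ge> 1" "\<Gamma> \<in> collections m"
        using * by (auto simp: minor_formation_scheme_def conjunctive_minor_def)
      show "preserves (k, f) \<Gamma>" if "k \<ge> 1" "(k, f) \<in> F" for k f
        using preserves_conjunctive_minor[OF that(1) *(1) _ *(3)] *(2) inD that(2) by blast
    qed
  qed
  show "closed_under_unions \<M>"
    unfolding closed_under_unions_def
  proof (intro allI impI)
    fix m :: nat and \<G> assume m: "m \<ge> 1" and \<G>: "\<G> \<subseteq> \<M> \<inter> collections m"
    then have coll: "\<Union>\<G> \<in> collections m"
      by (auto simp: collections_def)
    show "\<Union>\<G> \<in> \<M>"
    proof (rule inI[OF m coll], rule preservesI[OF coll])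
      fix n f M1 M2 M3
      assume nf: "(n, f) \<in> F" and "length M2 = n" and "M1 @ M2 @ M3 \<in> \<Union>\<G>"
      then obtain \<Gamma> where "\<Gamma> \<in> \<G>" "M1 @ M2 @ M3 \<in> \<Gamma>" by blast
      then show "M1 @ [apply_rows m f M2] @ M3 \<in> \<Union>\<G>"
        using preservesD[OF inD[OF _ nf], of \<Gamma> m M1 M2 M3] \<G> \<open>length M2 = n\<close> by blast
    qed
  qed
  show "closed_under_quotients \<M>"
    unfolding closed_under_quotients_def left_quotient_eq right_quotient_eq
  proof (intro allI impI ballI conjI)
    fix m :: nat and \<Gamma> and N :: "'a matrix" assume *: "m \<ge> 1" "\<Gamma> \<in> \<M> \<inter> collections m"
    have "two_sided_quotient N1 \<Gamma> N2 \<in> \<M>" for N1 N2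
      by (rule inI[OF *(1)], rule two_sided_quotient_in_collections,
          use * in blast, rule preserves_two_sided_quotient) (use * inD in blast)+
    then show "two_sided_quotient N \<Gamma> [] \<in> \<M>" "two_sided_quotient [] \<Gamma> N \<in> \<M>"
      by simp_all
  qed
  show "closed_under_dividends \<M>"
    unfolding closed_under_dividends_def
  proof (intro allI impI ballI, elim exE conjE)
    fix m p :: nat and \<Gamma>
    assume *: "m \<ge> 1" "\<Gamma> \<in> collections m" "trivial_collection m p \<subseteq> \<Gamma>"
      "\<forall>N1\<in>matrices m. \<forall>N2\<in>matrices m. length (N1 @ N2) \<ge> p \<longrightarrow> two_sided_quotient N1 \<Gamma> N2 \<in> \<M>"
    show "\<Gamma> \<in> \<M>"
      by (rule inI[OF *(1,2)], rule preserves_dividend[OF _ *(2,3)]) (use * inD in blast)+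
  qed
qed

section \<open>Collections generated by a matrix\<close>

inductive_set generated :: "nat \<Rightarrow> 'a operation set \<Rightarrow> ('a matrix \<times> 'a matrix) set"
  for m :: nat and F :: "'a operation set" where
  generated_Nil: "([], []) \<in> generated m F"
| generated_Cons: "(n, f) \<in> F \<Longrightarrow> length L = n \<Longrightarrow> (M, N) \<in> generated m F \<Longrightarrow>
    (L @ M, apply_rows m f L # N) \<in> generated m F"

lemma generated_append:
  "(M, N) \<in> generated m F \<Longrightarrow> (M', N') \<in> generated m F \<Longrightarrow> (M @ M', N @ N') \<in> generated m F"
  by (induction rule: generated.induct) (auto intro: generated.intros)

text \<open>Each output column comes from its own consecutive block of the input, so a cut of the
  output lifts to a cut of the input.\<close>

lemma generated_appendE:
  assumes "(M, N @ N') \<in> generated m F"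
  obtains L L' where "M = L @ L'" "(L, N) \<in> generated m F" "(L', N') \<in> generated m F"
  using assms
proof (induction N arbitrary: M thesis)
  case Nil
  then show ?case
    using generated_Nil by (metis append_Nil)
next
  case (Cons c N)
  from Cons.prems(2) obtain f K M' where
    *: "(length K, f) \<in> F" "M = K @ M'" "c = apply_rows m f K" "(M', N @ N') \<in> generated m F"
    by (auto elim: generated.cases)
  obtain L L' where "M' = L @ L'" "(L, N) \<in> generated m F" "(L', N') \<in> generated m F"
    using Cons.IH[OF _ *(4)] by blast
  then show ?case
    using Cons.prems(1)[of "K @ L" L'] * generated_Cons[OF *(1)] by simp
qed

text \<open>Arities are positive, so no output column can come from an empty block.\<close>

lemma generated_from_Nil:
  assumes "F \<subseteq> operations"
  shows "([], N) \<in> generated m F \<longleftrightarrow> N = []"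
proof
  assume "([], N) \<in> generated m F"
  then show "N = []"
    by cases (use assms in \<open>auto simp: operations_def\<close>)
qed (simp add: generated_Nil)

lemma generated_in_matrices: "(M, N) \<in> generated m F \<Longrightarrow> N \<in> matrices m"
  by (induction rule: generated.induct) auto

lemma generated_refl:
  assumes "(1, f) \<in> F" "\<And>x. f [x] = x" "M \<in> matrices m"
  shows "(M, M) \<in> generated m F"
  using assms(3)
proof (induction M)
  case (Cons c M)
  have "apply_rows m f [c] = c"
    using Cons.prems assms(2) by (auto intro: nth_equalityI)
  then show ?case
    using generated_Cons[OF assms(1), of "[c]" M M m] Cons by simp
qed (simp add: generated_Nil)

text \<open>The prefix \<open>L\<close> holds the columns already produced while the blocks are
  collapsed from left to right.\<close>

lemma generated_preserved:
  assumes "(M, N) \<in> generated m F" "\<And>f. f \<in> F \<Longrightarrow> preserves f \<Gamma>" "\<Gamma> \<in> collections m" "L @ M \<in> \<Gamma>"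
  shows "L @ N \<in> \<Gamma>"
  using assms(1,4)
proof (induction arbitrary: L rule: generated.induct)
  case (generated_Cons n f K M N)
  have "L @ [apply_rows m f K] @ M \<in> \<Gamma>"
    using preservesD[OF assms(2)[OF generated_Cons(1)] assms(3)] generated_Cons by simp
  then show ?case
    using generated_Cons.IH[of "L @ [apply_rows m f K]"] by simp
qed

section \<open>Closed sets are characterized by operations\<close>

text \<open>Indeterminates and indices may come from any types that embed into the universe: the
  scheme is renamed along \<open>e\<close> and \<open>g\<close>, and Skolem maps are transported by
  composition with \<open>e\<close> or its inverse.\<close>

lemma closed_under_conjunctive_minorsD:
  fixes V :: "'v set" and J :: "'j set" and e :: "'v \<Rightarrow> 'u" and g :: "'j \<Rightarrow> 'u"
  assumes closed: "closed_under_conjunctive_minors TYPE('u) \<M>"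
    and e: "inj_on e V" and g: "inj_on g J" and scheme: "minor_formation_scheme m V J n H"
    and \<Gamma>s: "\<And>j. j \<in> J \<Longrightarrow> \<Gamma>s j \<in> \<M> \<inter> collections (n j)"
    and minor: "conjunctive_minor m J H \<Gamma>s \<Gamma>"
  shows "\<Gamma> \<in> \<M>"
proof -
  define H' where "H' j = map (map_sum id e) (H (inv_into J g j))" for j
  let ?sub = "\<lambda>H j. map2 (\<lambda>a \<sigma>. substitute a \<sigma> (H j))"
  have inv_g [simp]: "inv_into J g (g j) = j" if "j \<in> J" for j
    using g that by simp
  have forget: "?sub H' (g j) M \<sigma>s = ?sub H j M (map (\<lambda>\<sigma>. \<sigma> \<circ> e) \<sigma>s)"
    if "j \<in> J" "length \<sigma>s = length M" for j M and \<sigma>s :: "('u \<Rightarrow> 'a) list"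
    using that by (intro nth_equalityI) (auto simp: substitute_def H'_def split: sum.split)
  \<comment> \<open>Outside \<open>e\<close>
    V\<open>the extended Skolem maps take junk values, but\<close>H'\<open>mentions indeterminates from\<close>e
    \<open>V\<close> only.\<close>
  have extend: "?sub H' (g j) M (map (\<lambda>\<sigma>. \<sigma> \<circ> inv_into V e) \<sigma>s) = ?sub H j M \<sigma>s"
    if "j \<in> J" "length \<sigma>s = length M" for j M and \<sigma>s :: "('v \<Rightarrow> 'a) list"
  proof -
    have "set (H j) \<subseteq> {..<m} <+> V"
      using scheme that by (auto simp: minor_formation_scheme_def)
    then have "substitute a (\<sigma> \<circ> inv_into V e) (H' (g j)) = substitute a \<sigma> (H j)"
      for a :: "'a list" and \<sigma>
      using that e by (auto simp: substitute_def H'_def)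
    then show ?thesis
      using that by (simp add: list_eq_iff_nth_eq[of "map2 _ _ _"])
  qed
  have 1: "minor_formation_scheme m (e ` V) (g ` J) (n \<circ> inv_into J g) H'"
    using scheme by (force simp: minor_formation_scheme_def H'_def)
  have 2: "\<forall>j\<in>g ` J. (\<Gamma>s \<circ> inv_into J g) j \<in> \<M> \<inter> collections ((n \<circ> inv_into J g) j)"
    using \<Gamma>s by simp
  have 3: "conjunctive_minor m (g ` J) H' (\<Gamma>s \<circ> inv_into J g) \<Gamma>"
    unfolding conjunctive_minor_def
  proof (intro conjI ballI impI)
    show "\<Gamma> \<in> collections m"
      using minor by (simp add: conjunctive_minor_def)
  next
    fix M :: "'a matrix" assume M: "M \<in> matrices m" "M \<noteq> []"
    have "M \<in> \<Gamma> \<longleftrightarrow> (\<exists>\<sigma>s. length \<sigma>s = length M \<and> (\<forall>j\<in>J. ?sub H j M \<sigma>s \<in> \<Gamma>s j))"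
      using minor M by (simp add: conjunctive_minor_def)
    also have "\<dots> \<longleftrightarrow> (\<exists>\<sigma>s. length \<sigma>s = length M \<and> (\<forall>j\<in>J. ?sub H' (g j) M \<sigma>s \<in> \<Gamma>s j))"
      (is "(\<exists>\<sigma>s. ?P \<sigma>s) \<longleftrightarrow> (\<exists>\<sigma>s. ?Q \<sigma>s)")
    proof
      assume "\<exists>\<sigma>s. ?P \<sigma>s"
      then obtain \<sigma>s where "?P \<sigma>s" ..
      then have "?Q (map (\<lambda>\<sigma>. \<sigma> \<circ> inv_into V e) \<sigma>s)"
        using extend by (metis length_map)
      then show "\<exists>\<sigma>s. ?Q \<sigma>s" ..
    next
      assume "\<exists>\<sigma>s. ?Q \<sigma>s"
      then obtain \<sigma>s where "?Q \<sigma>s" ..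
      then have "?P (map (\<lambda>\<sigma>. \<sigma> \<circ> e) \<sigma>s)"
        using forget by (metis length_map)
      then show "\<exists>\<sigma>s. ?P \<sigma>s" ..
    qed
    finally show "M \<in> \<Gamma> \<longleftrightarrow> (\<exists>\<sigma>s. length \<sigma>s = length M \<and>
        (\<forall>j\<in>g ` J. ?sub H' j M \<sigma>s \<in> (\<Gamma>s \<circ> inv_into J g) j))"
      by simp
  qed
  show ?thesis
    by (rule closed[unfolded closed_under_conjunctive_minors_def, rule_format,
          OF conjI[OF 1 conjI[OF 2 3]]])
qed

section \<open>First consequences of the closure conditions\<close>

locale closed_set =
  fixes \<M> :: "'a collection set" and universe :: "'u itself"
  assumes all_collections: "\<M> \<subseteq> all_collections"
    and equality: "equality_collection \<in> \<M>"
    and trivial: "trivial_collection 1 p \<in> \<M>"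
    and minors: "closed_under_conjunctive_minors TYPE('u + 'a collection) \<M>"
    and unions: "closed_under_unions \<M>"
    and quotients: "closed_under_quotients \<M>"
    and dividends: "closed_under_dividends \<M>"
begin

text \<open>Membership of the empty matrix is irrelevant here because conjunctive minors do not see it.\<close>

lemma Inter_in:
  assumes m: "m \<ge> 1" and \<G>: "\<G> \<noteq> {}" "\<G> \<subseteq> \<M> \<inter> collections m" and \<Gamma>: "\<Gamma> \<in> collections m"
    and eq: "\<And>M. M \<in> matrices m \<Longrightarrow> M \<noteq> [] \<Longrightarrow> M \<in> \<Gamma> \<longleftrightarrow> M \<in> \<Inter>\<G>"
  shows "\<Gamma> \<in> \<M>"
proof (rule closed_under_conjunctive_minorsD[OF minors])
  \<comment> \<open>There are no indeterminates and every map is the identity on \<open>m\<close>,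
    so the minor is the plain intersection. The members of \<open>\<G>\<close> index themselves
    through \<open>Inr\<close>.\<close>
  let ?H = "\<lambda>_. map Inl [0..<m] :: (nat + unit) list"
  show "inj_on (\<lambda>_ :: unit. undefined :: 'u + 'a collection) {}"
    by simp
  show "inj_on (Inr :: 'a collection \<Rightarrow> 'u + 'a collection) \<G>"
    by simp
  show "minor_formation_scheme m {} \<G> (\<lambda>_. m) ?H"
    using m \<G> by (auto simp: minor_formation_scheme_def)
  show "\<Gamma>' \<in> \<M> \<inter> collections m" if "\<Gamma>' \<in> \<G>" for \<Gamma>'
    using that \<G> by blast
  have sub: "substitute a \<sigma> (?H j) = a" if "length a = m" for a :: "'a list" and \<sigma> j
    using that by (auto simp: substitute_def intro: nth_equalityI)
  have "map2 (\<lambda>a \<sigma>. substitute a \<sigma> (?H j)) M \<sigma>s = M"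
    if "M \<in> matrices m" "length \<sigma>s = length M" for M :: "'a matrix" and \<sigma>s j
    using that by (intro nth_equalityI) (auto simp: sub matrices_def)
  then show "conjunctive_minor m \<G> ?H (\<lambda>\<Gamma>. \<Gamma>) \<Gamma>"
    using \<Gamma> eq unfolding conjunctive_minor_def by (auto intro: exI[of _ "replicate _ undefined"])
qed

text \<open>The \<open>i\<close>-th map of the scheme selects row \<open>i\<close>, and a row has as
  many entries as the matrix has columns.\<close>

lemma trivial_collection_in:
  assumes "m \<ge> 1"
  shows "trivial_collection m p \<in> \<M>"
proof (rule closed_under_conjunctive_minorsD[OF minors])
  let ?H = "\<lambda>i. [Inl i] :: (nat + unit) list"
  show "inj_on (\<lambda>_ :: unit. undefined :: 'u + 'a collection) {}"
    by simp
  \<comment> \<open>The matrices of \<open>i\<close> empty columns are pairwise distinct, so they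
    supply enough indices even over a one-element base set.\<close>
  show "inj_on (\<lambda>i. Inr {replicate i []} :: 'u + 'a collection) {..<m}"
    by (rule inj_onI) (metis length_replicate sum.inject(2) singleton_inject)
  show "minor_formation_scheme m {} {..<m} (\<lambda>_. 1) ?H"
    using assms by (auto simp: minor_formation_scheme_def lessThan_empty_iff)
  show "trivial_collection 1 p \<in> \<M> \<inter> collections 1"
    using trivial trivial_collection_in_collections by blast
  show "conjunctive_minor m {..<m} ?H (\<lambda>_. trivial_collection 1 p)
      (trivial_collection m p :: 'a collection)"
    unfolding conjunctive_minor_def
  proof (intro conjI ballI impI)
    fix M :: "'a matrix" assume "M \<in> matrices m"
    have *: "map2 (\<lambda>a \<sigma>. substitute a \<sigma> (?H i)) M \<sigma>s \<in> trivial_collection 1 p \<longleftrightarrow> length M \<le> p"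
      if "length \<sigma>s = length M" for \<sigma>s i
      using that by (auto simp: trivial_collection_def matrices_def)
    have "M \<in> trivial_collection m p \<longleftrightarrow> length M \<le> p"
      using \<open>M \<in> matrices m\<close> by (simp add: trivial_collection_def)
    also have "\<dots> \<longleftrightarrow> (\<exists>\<sigma>s. length \<sigma>s = length M \<and>
        (\<forall>i\<in>{..<m}. map2 (\<lambda>a \<sigma>. substitute a \<sigma> (?H i)) M \<sigma>s \<in> trivial_collection 1 p))"
      (is "_ \<longleftrightarrow> (\<exists>\<sigma>s. ?P \<sigma>s)")
    proof
      assume "length M \<le> p"
      then have "?P \<sigma>s" if "length \<sigma>s = length M" for \<sigma>s
        using * that by blast
      then show "\<exists>\<sigma>s. ?P \<sigma>s"
        using Ex_list_of_length by blast
    next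
      assume "\<exists>\<sigma>s. ?P \<sigma>s"
      moreover have "0 \<in> {..<m}"
        using assms by simp
      ultimately show "length M \<le> p"
        using * by blast
    qed
    finally show "M \<in> trivial_collection m p \<longleftrightarrow> (\<exists>\<sigma>s. length \<sigma>s = length M \<and>
        (\<forall>i\<in>{..<m}. map2 (\<lambda>a \<sigma>. substitute a \<sigma> (?H i)) M \<sigma>s \<in> trivial_collection 1 p))" .
  qed (rule trivial_collection_in_collections)
qed

lemma two_sided_quotient_in:
  assumes "m \<ge> 1" "\<Gamma> \<in> \<M>" "\<Gamma> \<in> collections m" "N1 \<in> matrices m" "N2 \<in> matrices m"
  shows "two_sided_quotient N1 \<Gamma> N2 \<in> \<M>"
proof -
  have "left_quotient N1 \<Gamma> \<in> \<M>" "left_quotient N1 \<Gamma> \<in> collections m"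
    using assms quotients two_sided_quotient_in_collections
    by (auto simp: closed_under_quotients_def left_quotient_eq)
  then have "right_quotient (left_quotient N1 \<Gamma>) N2 \<in> \<M>"
    using assms quotients by (auto simp: closed_under_quotients_def)
  then show ?thesis
    by (simp add: right_quotient_def left_quotient_def two_sided_quotient_def)
qed

section \<open>Polymorphisms of the closed set\<close>

definition polymorphisms :: "'a operation set" where
  "polymorphisms = {f \<in> operations. \<forall>\<Gamma> \<in> \<M>. preserves f \<Gamma>}"

text \<open>Closure under quotients absorbs the context: the step takes place in the quotient by
  \<open>M1\<close> and \<open>M3\<close>, where the block is the whole matrix.\<close>

lemma polymorphismsI:
  assumes f: "(n, f) \<in> operations"
    and single: "\<And>m \<Gamma> M. m \<ge> 1 \<Longrightarrow> \<Gamma> \<in> \<M> \<Longrightarrow> \<Gamma> \<in> collections m \<Longrightarrow> length M = n \<Longrightarrow> M \<in> \<Gamma> \<Longrightarrow>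
      [apply_rows m f M] \<in> \<Gamma>"
  shows "(n, f) \<in> polymorphisms"
proof -
  have "preserves (n, f) \<Gamma>" if "\<Gamma> \<in> \<M>" for \<Gamma>
  proof -
    obtain m where m: "m \<ge> 1" "\<Gamma> \<in> collections m"
      using \<open>\<Gamma> \<in> \<M>\<close> all_collections by (auto simp: all_collections_def)
    show ?thesis
    proof (rule preservesI[OF m(2)])
      show "n \<ge> 1"
        using f by (simp add: operations_def)
      fix M1 M2 M3
      assume M: "M1 \<in> matrices m" "M2 \<in> matrices m" "M3 \<in> matrices m" "length M2 = n"
        "M1 @ M2 @ M3 \<in> \<Gamma>"
      then have "M2 \<in> two_sided_quotient M1 \<Gamma> M3"
        by (simp add: two_sided_quotient_def)
      then have "[apply_rows m f M2] \<in> two_sided_quotient M1 \<Gamma> M3"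
        using M m that single two_sided_quotient_in two_sided_quotient_in_collections by blast
      then show "M1 @ [apply_rows m f M2] @ M3 \<in> \<Gamma>"
        by (simp add: two_sided_quotient_def)
    qed
  qed
  then show ?thesis
    using f by (simp add: polymorphisms_def)
qed

lemma generated_polymorphisms_refl:
  assumes "M \<in> matrices m"
  shows "(M, M) \<in> generated m polymorphisms"
proof (rule generated_refl[OF _ _ assms])
  \<comment> \<open>The unary identity, restricted to lists of length one because operations are
    extensional.\<close>
  let ?f = "\<lambda>xs \<in> {xs. length xs = 1}. hd xs :: 'a"
  show "(1, ?f) \<in> polymorphisms"
  proof (rule polymorphismsI)
    fix m \<Gamma> and M :: "'a matrix"
    assume *: "\<Gamma> \<in> collections m" "length M = 1" "M \<in> \<Gamma>"
    then obtain c where M: "M = [c]"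
      by (auto simp: length_Suc_conv)
    then have "length c = m"
      using * by (auto simp: collections_def)
    then have "apply_rows m ?f [c] = c"
      by (auto intro: nth_equalityI)
    then show "[apply_rows m ?f M] \<in> \<Gamma>"
      using M * by simp
  qed (simp add: operations_def)
qed simp

text \<open>The indices of the conjunctive minor are the lists over \<open>{..<m} <+> A\<^sup>n\<close>, each of them being its own
  map \<open>h\<^sub>j\<close>.  Reading \<open>Inl i\<close> as row \<open>i\<close> of \<open>M\<close> and \<open>Inr v\<close> as the row \<open>v\<close>, such a list yields a
  matrix with \<open>n\<close> columns, and its source is the least member of \<open>\<M>\<close> containing this matrix.\<close>

lemma single_column_minor:
  assumes m: "m \<ge> 1" and M: "M \<in> matrices m" "M \<noteq> []"
  obtains \<Delta> where "\<Delta> \<in> \<M>" "\<Delta> \<in> collections m" "M \<in> \<Delta>"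
    "\<And>b. [b] \<in> \<Delta> \<Longrightarrow> (M, [b]) \<in> generated m polymorphisms"
proof -
  define n where "n = length M"
  define V :: "'a list set" where "V = {v. length v = n}"
  define J where "J = lists ({..<m} <+> V) - {[]}"
  define row where "row = case_sum (\<lambda>i. map (\<lambda>c. c ! i) M) (\<lambda>v :: 'a list. v)"
  define mat where "mat R = map (\<lambda>j. map (\<lambda>r. row r ! j) R) [0..<n]" for R
  define least where "least R = \<Inter>{\<Gamma> \<in> \<M> \<inter> collections (length R). mat R \<in> \<Gamma>}" for R
  have mat_in: "mat R \<in> trivial_collection (length R) n" for R
    by (auto simp: mat_def trivial_collection_def matrices_def)
  have J: "length R \<ge> 1 \<and> set R \<subseteq> {..<m} <+> V" if "R \<in> J" for R
    using that by (cases R) (auto simp: J_def)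
  have least: "least R \<in> \<M> \<inter> collections (length R)" if "R \<in> J" for R
  proof -
    have R: "length R \<ge> 1"
      using J that by blast
    let ?\<G> = "{\<Gamma> \<in> \<M> \<inter> collections (length R). mat R \<in> \<Gamma>}"
    \<comment> \<open>This member makes the intersected family nonempty, as a conjunctive minor
      requires.\<close>
    have ne: "trivial_collection (length R) n \<in> ?\<G>"
      using mat_in trivial_collection_in[OF R] trivial_collection_in_collections by blast
    then have "least R \<in> collections (length R)"
      unfolding least_def collections_def by blast
    moreover from this have "least R \<in> \<M>"
      using ne by (intro Inter_in[OF R, of ?\<G>]) (auto simp: least_def)
    ultimately show ?thesis by blast
  qed
  have least_subset: "least R \<subseteq> \<Gamma>" if "\<Gamma> \<in> \<M>" "\<Gamma> \<in> collections (length R)" "mat R \<in> \<Gamma>" for R \<Gamma>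
    using that by (auto simp: least_def)
  let ?sub = "\<lambda>R. map2 (\<lambda>a \<sigma>. substitute a \<sigma> R)"
  define \<Delta> where "\<Delta> = {X \<in> matrices m.
    \<exists>\<sigma>s :: ('a list \<Rightarrow> 'a) list. length \<sigma>s = length X \<and> (\<forall>R\<in>J. ?sub R X \<sigma>s \<in> least R)}"
  show ?thesis
  proof
    show "\<Delta> \<in> collections m"
      by (auto simp: \<Delta>_def collections_def)
    \<comment> \<open>Indices are lists over rows and indeterminates and must be embedded into
      matrices. Indeterminates have length \<open>n\<close>, so row \<open>i\<close> is coded by a
      list of length \<open>n + 1 + i\<close>.\<close>
    define code where "code = case_sum (\<lambda>i. replicate (n + 1 + i) (undefined :: 'a)) (\<lambda>v. v)"
    have code: "inj_on code (UNIV <+> V)"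
      by (rule inj_on_inverseI[of _ "\<lambda>v. if length v = n then Inr v else Inl (length v - (n + 1))"])
        (auto simp: code_def V_def)
    show "\<Delta> \<in> \<M>"
    proof (rule closed_under_conjunctive_minorsD[OF minors])
      show "inj_on (\<lambda>v. Inr {[v]} :: 'u + 'a collection) V"
        by (auto simp: inj_on_def)
      have "inj_on (map code) J"
        by (rule inj_on_mapI, rule inj_on_subset[OF code]) (auto simp: J_def)
      then show "inj_on (\<lambda>R. Inr {map code R} :: 'u + 'a collection) J"
        by (auto simp: inj_on_def)
      have "[Inl 0] \<in> J"
        using m by (auto simp: J_def)
      then show "minor_formation_scheme m V J length (\<lambda>R. R)"
        using m J unfolding minor_formation_scheme_def by blast
      show "conjunctive_minor m J (\<lambda>R. R) least \<Delta>"
        by (auto simp: conjunctive_minor_def \<Delta>_def collections_def)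
    qed (rule least)
    \<comment> \<open>The Skolem maps witnessing \<open>M \<in> \<Delta>\<close> are the
      projections: at column \<open>j\<close> the indeterminate \<open>v\<close> takes the value
      \<open>v ! j\<close>.\<close>
    have "?sub R M (map (\<lambda>j v. v ! j) [0..<n]) = mat R" if "R \<in> J" for R
    proof (rule nth_equalityI)
      fix j assume j: "j < length (?sub R M (map (\<lambda>j v. v ! j) [0..<n]))"
      have "substitute (M ! j) (\<lambda>v. v ! j) R = map (\<lambda>r. row r ! j) R"
        using j by (auto simp: substitute_def row_def n_def split: sum.split)
      then show "?sub R M (map (\<lambda>j v. v ! j) [0..<n]) ! j = mat R ! j"
        using j by (simp add: mat_def n_def)
    qed (simp add: mat_def n_def)
    moreover have "mat R \<in> least R" for R
      by (auto simp: least_def)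
    ultimately show "M \<in> \<Delta>"
      using M by (auto simp: \<Delta>_def n_def intro!: exI[of _ "map (\<lambda>j v. v ! j) [0..<n]"])
  next
    fix b assume "[b] \<in> \<Delta>"
    then obtain \<sigma>s where "length b = m" "length \<sigma>s = length [b]"
      and \<sigma>s: "\<forall>R\<in>J. ?sub R [b] \<sigma>s \<in> least R"
      by (auto simp: \<Delta>_def)
    then obtain \<sigma> where "\<sigma>s = [\<sigma>]"
      by (auto simp: length_Suc_conv)
    with \<sigma>s have \<sigma>: "[substitute b \<sigma> R] \<in> least R" if "R \<in> J" for R
      using that by simp
    \<comment> \<open>A one-column matrix has a single Skolem map, and on lists of length
      \<open>n\<close> it is an \<open>n\<close>-ary operation.\<close>
    define f where "f = restrict \<sigma> {xs. length xs = n}"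
    have "(n, f) \<in> polymorphisms"
    proof (rule polymorphismsI)
      show "(n, f) \<in> operations"
        using M by (auto simp: operations_def f_def n_def Suc_le_eq)
      fix k \<Gamma> X
      assume *: "k \<ge> 1" "\<Gamma> \<in> \<M>" "\<Gamma> \<in> collections k" "length X = n" "X \<in> \<Gamma>"
      \<comment> \<open>The rows of \<open>X\<close> themselves, taken as indeterminates; then
        \<open>mat R = X\<close> and \<open>least R\<close> is contained in
        \<open>\<Gamma>\<close>.\<close>
      define R :: "(nat + 'a list) list" where "R = map (\<lambda>i. Inr (map (\<lambda>c. c ! i) X)) [0..<k]"
      have "X \<in> matrices k"
        using * by (auto simp: collections_def)
      have "R \<in> J"
        using * by (auto simp: J_def R_def V_def)
      have "mat R = X"
        using \<open>X \<in> matrices k\<close> \<open>length X = n\<close>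
        by (auto simp: list_eq_iff_nth_eq mat_def R_def row_def matrices_def)
      then have "[substitute b \<sigma> R] \<in> \<Gamma>"
        using \<sigma>[OF \<open>R \<in> J\<close>] least_subset[of \<Gamma> R] * by (auto simp: R_def)
      moreover have "substitute b \<sigma> R = apply_rows k f X"
        using \<open>length X = n\<close> by (auto simp: substitute_def R_def apply_rows_def f_def)
      ultimately show "[apply_rows k f X] \<in> \<Gamma>"
        by simp
    qed
    moreover have "apply_rows m f M = b"
    proof (rule nth_equalityI)
      fix i assume "i < length (apply_rows m f M)"
      then have i: "i < m" by simp
      \<comment> \<open>Row \<open>i\<close> of \<open>M\<close> is paired with the indeterminate
        equal to it. Both rows of \<open>mat R\<close> agree, so \<open>least R\<close> lies in the
        equality collection, which forces \<open>b ! i\<close> to be the value of \<open>f\<close>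
        at that row.\<close>
      define R where "R = [Inl i, Inr (map (\<lambda>c. c ! i) M)]"
      have "R \<in> J"
        using i by (auto simp: J_def R_def V_def n_def)
      moreover have "mat R \<in> equality_collection"
        by (auto simp: mat_def R_def row_def equality_collection_def matrices_def)
      moreover have "equality_collection \<in> collections (length R)"
        using equality_collection_in_collections by (simp add: R_def numeral_2_eq_2)
      ultimately have "[substitute b \<sigma> R] \<in> equality_collection"
        using \<sigma> least_subset equality by blast
      then show "apply_rows m f M ! i = b ! i"
        using i by (simp add: equality_collection_def R_def substitute_def f_def n_def)
    qed (use \<open>length b = m\<close> in simp)
    ultimately show "(M, [b]) \<in> generated m polymorphisms"
      using generated_Cons[OF _ n_def[symmetric] generated_Nil, of f polymorphisms m] by simp
  qed
qed

section \<open>Generated collections belong to the closed set\<close>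

lemma generated_in:
  assumes m: "m \<ge> 1" and "M \<in> matrices m"
  shows "{N. (M, N) \<in> generated m polymorphisms} \<in> \<M>"
  using assms(2)
proof (induction M rule: length_induct)
  case (1 M)
  let ?G = "\<lambda>M. {N. (M, N) \<in> generated m polymorphisms}"
  have coll: "?G L \<in> collections m" for L
    using generated_in_matrices by (auto simp: collections_def)
  have ops: "polymorphisms \<subseteq> operations"
    by (auto simp: polymorphisms_def)
  show ?case
  proof (cases "M = []")
    case True
    \<comment> \<open>The collection generated by the empty matrix agrees with the empty union on
      all nonempty matrices.\<close>
    have "\<Union>{} \<in> \<M>"
      using unions m unfolding closed_under_unions_def by blast
    then show ?thesis
      using True generated_from_Nil[OF ops] coll
      by (intro Inter_in[OF m, of "{{}}"]) (auto simp: collections_def)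
  next
    case False
    obtain \<Delta> where \<Delta>: "\<Delta> \<in> \<M>" "\<Delta> \<in> collections m" "M \<in> \<Delta>"
      and single: "\<And>b. [b] \<in> \<Delta> \<Longrightarrow> (M, [b]) \<in> generated m polymorphisms"
      using single_column_minor[OF m 1(2) False] by blast
    \<comment> \<open>Adding all matrices of at most one column allows a dividend argument with
      \<open>p = 1\<close>, where only quotients by nonempty contexts matter.\<close>
    define \<Lambda> where "\<Lambda> = trivial_collection m 1 \<union> ?G M"
    have \<Lambda>_coll: "\<Lambda> \<in> collections m"
      using coll[of M] by (auto simp: \<Lambda>_def trivial_collection_def collections_def)
    have "two_sided_quotient N1 \<Lambda> N2 \<in> \<M>"
      if N: "N1 \<in> matrices m" "N2 \<in> matrices m" "length (N1 @ N2) \<ge> 1" for N1 N2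
    proof -
      define \<G> where "\<G> = {?G L | L1 L L2. M = L1 @ L @ L2 \<and> N1 \<in> ?G L1 \<and> N2 \<in> ?G L2}"
      have "\<G> \<subseteq> \<M> \<inter> collections m"
      proof
        fix \<Gamma> assume "\<Gamma> \<in> \<G>"
        then obtain L1 L L2 where L: "M = L1 @ L @ L2" "N1 \<in> ?G L1" "N2 \<in> ?G L2" "\<Gamma> = ?G L"
          by (auto simp: \<G>_def)
        \<comment> \<open>\<open>N1\<close> or \<open>N2\<close> is nonempty and so uses up at least
          one column of \<open>M\<close>; this makes the induction hypothesis apply to
          \<open>L\<close>.\<close>
        have "L1 \<noteq> [] \<or> L2 \<noteq> []"
          using L(2,3) N(3) generated_from_Nil[OF ops] by auto
        then have "length L < length M"
          using L by auto
        then show "\<Gamma> \<in> \<M> \<inter> collections m"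
          using L 1 coll by simp
      qed
      then have "\<Union>\<G> \<in> \<M>" "\<Union>\<G> \<in> collections m"
        using unions m unfolding closed_under_unions_def collections_def by blast+
      moreover have "X \<in> two_sided_quotient N1 \<Lambda> N2 \<longleftrightarrow> X \<in> \<Union>\<G>" if "X \<noteq> []" for X
      proof
        assume "X \<in> two_sided_quotient N1 \<Lambda> N2"
        \<comment> \<open>With more than one column, membership in \<open>\<Lambda>\<close> must
          come from the generated part.\<close>
        moreover have "length (N1 @ X @ N2) > 1"
          using N(3) \<open>X \<noteq> []\<close> by (cases X) auto
        ultimately have "(M, N1 @ X @ N2) \<in> generated m polymorphisms"
          by (auto simp: two_sided_quotient_def \<Lambda>_def trivial_collection_def)
        then show "X \<in> \<Union>\<G>"
          unfolding \<G>_def by (elim generated_appendE) blast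
      next
        assume "X \<in> \<Union>\<G>"
        then show "X \<in> two_sided_quotient N1 \<Lambda> N2"
          by (auto simp: \<G>_def two_sided_quotient_def \<Lambda>_def intro!: generated_append)
      qed
      ultimately show ?thesis
        using two_sided_quotient_in_collections[OF \<Lambda>_coll]
        by (intro Inter_in[OF m, of "{\<Union>\<G>}"]) auto
    qed
    then have "\<Lambda> \<in> \<M>"
      using dividends m \<Lambda>_coll unfolding closed_under_dividends_def
      by (metis \<Lambda>_def Un_upper1)
    \<comment> \<open>\<open>\<Lambda>\<close> decides the matrices with at least two columns,
      \<open>\<Delta>\<close> those with exactly one.\<close>
    moreover have "N \<in> ?G M \<longleftrightarrow> N \<in> \<Inter>{\<Lambda>, \<Delta>}" if "N \<noteq> []" for N
    proof
      assume "N \<in> ?G M"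
      then show "N \<in> \<Inter>{\<Lambda>, \<Delta>}"
        using generated_preserved[of M N m polymorphisms \<Delta> "[]"] \<Delta>
        by (auto simp: \<Lambda>_def polymorphisms_def)
    next
      assume N: "N \<in> \<Inter>{\<Lambda>, \<Delta>}"
      show "N \<in> ?G M"
      proof (cases "length N \<le> 1")
        case True
        then obtain b where "N = [b]"
          using \<open>N \<noteq> []\<close> by (cases N) auto
        then show ?thesis
          using single N by simp
      next
        case False
        then show ?thesis
          using N by (simp add: \<Lambda>_def trivial_collection_def)
      qed
    qed
    ultimately show ?thesis
      using \<Delta> \<Lambda>_coll coll by (intro Inter_in[OF m, of "{\<Lambda>, \<Delta>}"]) auto
  qed
qed

lemma characterized: "characterized_by_operations \<M>"
  unfolding characterized_by_operations_def
proof (intro exI conjI equalityI subsetI)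
  show "f \<in> operations" if "f \<in> polymorphisms" for f
    using that by (simp add: polymorphisms_def)
  show "\<Gamma> \<in> {\<Gamma> \<in> all_collections. \<forall>f\<in>polymorphisms. preserves f \<Gamma>}" if "\<Gamma> \<in> \<M>" for \<Gamma>
    using that all_collections by (auto simp: polymorphisms_def)
next
  fix \<Gamma> assume "\<Gamma> \<in> {\<Gamma> \<in> all_collections. \<forall>f\<in>polymorphisms. preserves f \<Gamma>}"
  then obtain m where m: "m \<ge> 1" "\<Gamma> \<in> collections m"
    and \<Gamma>: "\<And>f. f \<in> polymorphisms \<Longrightarrow> preserves f \<Gamma>"
    by (auto simp: all_collections_def)
  let ?\<G> = "(\<lambda>M. {N. (M, N) \<in> generated m polymorphisms}) ` \<Gamma>"
  have mat: "M \<in> matrices m" if "M \<in> \<Gamma>" for M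
    using that m by (auto simp: collections_def)
  \<comment> \<open>Each \<open>M\<close> generates itself, and preservation keeps everything it
    generates inside \<open>\<Gamma>\<close>.\<close>
  have "\<Gamma> = \<Union>?\<G>"
    using generated_polymorphisms_refl mat generated_preserved[of _ _ m polymorphisms \<Gamma> "[]"] \<Gamma> m
    by auto
  moreover have "?\<G> \<subseteq> \<M> \<inter> collections m"
    using generated_in[OF m(1)] mat generated_in_matrices by (fastforce simp: collections_def)
  then have "\<Union>?\<G> \<in> \<M>"
    using unions m(1) unfolding closed_under_unions_def by blast
  ultimately show "\<Gamma> \<in> \<M>"
    by (rule ssubst)
qed

end

theorem theorem9:
  fixes \<M> :: "'a collection set"
  assumes "\<M> \<subseteq> all_collections"
  shows "(locally_closed \<M> \<and>
          equality_collection \<in> \<M> \<and>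
          {} \<in> \<M> \<and>
          (\<forall>p. trivial_collection 1 p \<in> \<M>) \<and>
          closed_under_conjunctive_minors TYPE('u + 'a collection) \<M> \<and>
          closed_under_unions \<M> \<and>
          closed_under_quotients \<M> \<and>
          closed_under_dividends \<M>)
     \<longleftrightarrow> characterized_by_operations \<M>"
proof
  assume "locally_closed \<M> \<and> equality_collection \<in> \<M> \<and> {} \<in> \<M> \<and>
    (\<forall>p. trivial_collection 1 p \<in> \<M>) \<and>
    closed_under_conjunctive_minors TYPE('u + 'a collection) \<M> \<and>
    closed_under_unions \<M> \<and> closed_under_quotients \<M> \<and> closed_under_dividends \<M>"
  then interpret closed_set \<M> "TYPE('u)"
    using assms by (simp add: closed_set_def)
  show "characterized_by_operations \<M>"
    by (rule characterized)
next
  assume "characterized_by_operations \<M>"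
  then obtain F where "F \<subseteq> operations" "\<M> = {\<Gamma> \<in> all_collections. \<forall>f \<in> F. preserves f \<Gamma>}"
    unfolding characterized_by_operations_def by blast
  then show "locally_closed \<M> \<and> equality_collection \<in> \<M> \<and> {} \<in> \<M> \<and>
    (\<forall>p. trivial_collection 1 p \<in> \<M>) \<and>
    closed_under_conjunctive_minors TYPE('u + 'a collection) \<M> \<and>
    closed_under_unions \<M> \<and> closed_under_quotients \<M> \<and> closed_under_dividends \<M>"
    using closure_properties_if_characterized[of F \<M>] by blast
qed

end
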